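(* Let $J^*\in\mathbb{R}^{n\times n}$ be a matrix (the Jacobian of the iteration map at its fixed point) all of whose eigenvalues are real, with $\lambda_{min}(J^* )=0$ and $\lambda_{max}(J^* )=\rho_{org}$ where $0<\rho_{org}<1$. Let $B:=I-J^*$, so that $a:=\lambda_{min}(B)=1-\rho_{org}$ and $b:=\lambda_{max}(B)=1$. Then for all sufficiently large positive integers $T$, $$q_{CI}^*<q_{CI}(T)<\rho_{org}.$$
   Context: $\lambda_{min}(\cdot)$ and $\lambda_{max}(\cdot)$ denote the minimum and maximum eigenvalues of a matrix with real eigenvalues. For a positive integer $T$ and $a<b$ as in the claim, $$q_{CI}(T):=\left[\mathrm{sech}\left(T\cosh^{-1}\left(\frac{b+a}{b-a}\right)\right)\right]^{1/T},\qquad q_{CI}^*:=\lim_{T\to\infty}q_{CI}(T)=\exp\left(-\cosh^{-1}\left(\frac{b+a}{b-a}\right)\right).$$ Here $q_{CI}(T)$ is the per-iteration local convergence rate bound of the Chebyshev inertial iteration of period $T$, and $\rho_{org}=\rho(J^* )$ is the local convergence rate of the original fixed-point iteration $x^{(k+1)}=f(x^{(k)})$. *)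

theory Defs
  imports "Jordan_Normal_Form.Spectral_Radius" "HOL-Real_Asymp.Real_Asymp"
begin

definition all_eigenvalues_real :: "real mat \<Rightarrow> bool" where
  "all_eigenvalues_real A \<longleftrightarrow> spectrum (map_mat complex_of_real A) \<subseteq> \<real>"

(* spectrum A contains the eigenvalues of A in the field of its entries, so for a real matrix
   the next two are the extreme eigenvalues provided all_eigenvalues_real A holds. *)

definition lambda_min :: "real mat \<Rightarrow> real" where
  "lambda_min A = Min (spectrum A)"

definition lambda_max :: "real mat \<Rightarrow> real" where
  "lambda_max A = Max (spectrum A)"

definition sech :: "real \<Rightarrow> real" where
  "sech x = 1 / cosh x"

definition q_CI :: "real \<Rightarrow> real \<Rightarrow> nat \<Rightarrow> real" where
  "q_CI a b T = sech (real T * arcosh ((b + a) / (b - a))) powr (1 / real T)"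

definition q_CI_star :: "real \<Rightarrow> real \<Rightarrow> real" where
  "q_CI_star a b = lim (q_CI a b)"

(* The limit exists and has the expected closed form, so lim is not a junk value above. *)

lemma q_CI_tendsto:
  assumes "0 < a" "a < b"
  shows "q_CI a b \<longlonglongrightarrow> exp (- arcosh ((b + a) / (b - a)))"
proof -
  define t where "t = arcosh ((b + a) / (b - a))"
  have "(b + a) / (b - a) > 1"
    using assms by (simp add: field_simps)
  then have t: "t > 0"
    unfolding t_def using arcosh_less_iff_real[of 1 "(b + a) / (b - a)"] by simp
  then have "(\<lambda>T::nat. (1 / ((exp (real T * t) + exp (- (real T * t))) / 2)) powr (1 / real T))
      \<longlonglongrightarrow> exp (- t)"
    by real_asymp
  then show ?thesis
    unfolding q_CI_def sech_def cosh_field_def t_def .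
qed

lemma q_CI_star_eq:
  assumes "0 < a" "a < b"
  shows "q_CI_star a b = exp (- arcosh ((b + a) / (b - a)))"
  unfolding q_CI_star_def using q_CI_tendsto[OF assms] by (rule limI)

end

theory Submission
  imports Defs
begin

text \<open>Write \<open>t = arcosh ((b + a) / (b - a)) > 0\<close>. The elementary inequality \<open>cosh x < exp x\<close> for
  \<open>x > 0\<close> does all the work: at \<open>x = T t\<close> it gives \<open>q_CI_star < q_CI T\<close>, and at \<open>x = t\<close> it gives
  \<open>q_CI_star < (b - a) / (b + a)\<close>, which for \<open>a = 1 - \<rho>\<close> and \<open>b = 1\<close> equals \<open>\<rho> / (2 - \<rho>) < \<rho>\<close>.
  As \<open>q_CI T\<close> tends to \<open>q_CI_star\<close>, it is eventually below \<open>\<rho>\<close>.\<close>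

text \<open>Both matrices have the same eigenvectors:
  \<open>v - A *\<^sub>v v = k \<cdot>\<^sub>v v\<close> rearranges entrywise.\<close>

lemma eigenvalue_one_minus_iff:
  fixes A :: "'a :: comm_ring_1 mat"
  assumes A: "A \<in> carrier_mat n n"
  shows "eigenvalue (1\<^sub>m n - A) k \<longleftrightarrow> eigenvalue A (1 - k)"
proof -
  have "(1\<^sub>m n - A) *\<^sub>v v = k \<cdot>\<^sub>v v \<longleftrightarrow> A *\<^sub>v v = (1 - k) \<cdot>\<^sub>v v" if v: "v \<in> carrier_vec n" for v
  proof -
    have "(1\<^sub>m n - A) *\<^sub>v v = v - A *\<^sub>v v"
      using A v by (simp add: minus_mult_distrib_mat_vec[of _ n n])
    moreover have "v - A *\<^sub>v v = k \<cdot>\<^sub>v v \<longleftrightarrow> A *\<^sub>v v = (1 - k) \<cdot>\<^sub>v v"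
    proof -
      have "v $ i - (A *\<^sub>v v) $ i = k * v $ i \<longleftrightarrow> (A *\<^sub>v v) $ i = (1 - k) * v $ i" for i
        by (auto simp: algebra_simps)
      then show ?thesis
        \<comment> \<open>Entries of \<open>A *\<^sub>v v\<close> must stay folded to match the
          entrywise equivalence.\<close>
        using A v by (simp add: vec_eq_iff del: index_mult_mat_vec)
    qed
    ultimately show ?thesis by simp
  qed
  moreover have "dim_row (1\<^sub>m n - A) = n" "dim_row A = n"
    using A by auto
  ultimately show ?thesis
    unfolding eigenvalue_def eigenvector_def by auto
qed

lemma spectrum_one_minus:
  fixes A :: "'a :: comm_ring_1 mat"
  assumes "A \<in> carrier_mat n n"
  shows "spectrum (1\<^sub>m n - A) = (\<lambda>x. 1 - x) ` spectrum A"
proof -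
  have "k \<in> (\<lambda>x. 1 - x) ` spectrum A \<longleftrightarrow> 1 - k \<in> spectrum A" for k
    by (auto intro: image_eqI[where x = "1 - k"])
  then show ?thesis
    by (auto simp: spectrum_def eigenvalue_one_minus_iff[OF assms])
qed

text \<open>Over the complex numbers an eigenvalue exists; being real, it is a root of the real
  characteristic polynomial. This makes \<open>Min\<close> and \<open>Max\<close> of the real
  spectrum meaningful.\<close>

lemma spectrum_nonempty_if_all_eigenvalues_real:
  assumes A: "A \<in> carrier_mat n n" and n: "n > 0" and real: "all_eigenvalues_real A"
  shows "spectrum A \<noteq> {}"
proof -
  let ?C = "map_mat complex_of_real A"
  have C: "?C \<in> carrier_mat n n" using A by simp
  obtain z where z: "z \<in> spectrum ?C"
    using spectrum_non_empty[OF C] n by auto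
  then obtain x where x: "z = complex_of_real x"
    using real unfolding all_eigenvalues_real_def by (auto elim: Reals_cases)
  have "poly (char_poly ?C) z = 0"
    using z eigenvalue_root_char_poly[OF C] by (simp add: spectrum_def)
  then have "poly (char_poly A) x = 0"
    unfolding x by (simp add: of_real_hom.char_poly_hom[OF A])
  then show ?thesis
    using eigenvalue_root_char_poly[OF A] by (auto simp: spectrum_def)
qed

text \<open>The map \<open>x \<mapsto> 1 - x\<close> reverses the order, so it swaps the extremes of
  the finite nonempty spectrum.\<close>

lemma
  assumes A: "A \<in> carrier_mat n n" and n: "n > 0" and real: "all_eigenvalues_real A"
  shows lambda_min_one_minus: "lambda_min (1\<^sub>m n - A) = 1 - lambda_max A"
    and lambda_max_one_minus: "lambda_max (1\<^sub>m n - A) = 1 - lambda_min A"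
proof -
  have fin: "finite (spectrum A)" and ne: "spectrum A \<noteq> {}"
    using card_finite_spectrum(1)[OF A] spectrum_nonempty_if_all_eigenvalues_real[OF assms] by auto
  show "lambda_min (1\<^sub>m n - A) = 1 - lambda_max A"
    unfolding lambda_min_def lambda_max_def spectrum_one_minus[OF A]
    by (rule Min_eqI) (use fin ne in \<open>auto intro!: imageI Min_in Max_in\<close>)
  show "lambda_max (1\<^sub>m n - A) = 1 - lambda_min A"
    unfolding lambda_min_def lambda_max_def spectrum_one_minus[OF A]
    by (rule Max_eqI) (use fin ne in \<open>auto intro!: imageI Min_in Max_in\<close>)
qed

lemma exp_minus_less_sech:
  assumes "x > 0"
  shows "exp (- x) < sech x"
proof -
  have "cosh x < exp x"
    \<comment> \<open>\<open>cosh x\<close> is the mean of \<open>exp x\<close> and the smaller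
      \<open>exp (- x)\<close>.\<close>
    using assms by (simp add: cosh_field_def)
  then show ?thesis
    using cosh_real_pos[of x] by (simp add: sech_def exp_minus field_simps)
qed

lemma arcosh_ratio_pos:
  fixes a b :: real
  assumes "0 < a" "a < b"
  shows "arcosh ((b + a) / (b - a)) > 0"
  using assms arcosh_less_iff_real[of 1 "(b + a) / (b - a)"] by (simp add: field_simps)

lemma q_CI_star_less_q_CI:
  assumes ab: "0 < a" "a < b" and T: "T > 0"
  shows "q_CI_star a b < q_CI a b T"
proof -
  define t where "t = arcosh ((b + a) / (b - a))"
  have t: "t > 0"
    unfolding t_def by (rule arcosh_ratio_pos[OF ab])
  \<comment> \<open>Written as a \<open>T\<close>-th root, the limit can be compared with
    \<open>q_CI\<close> under the root.\<close>
  have "exp (- t) = exp (- (real T * t)) powr (1 / real T)"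
    using T by (simp add: powr_def)
  also have "\<dots> < sech (real T * t) powr (1 / real T)"
    using T t by (intro powr_less_mono2 exp_minus_less_sech) auto
  finally show ?thesis
    by (simp add: q_CI_star_eq[OF ab] q_CI_def t_def)
qed

text \<open>The bound is \<open>sech t\<close> for \<open>t = arcosh ((b + a) / (b - a))\<close>,
  that is, \<open>q_CI a b 1\<close>.\<close>

lemma q_CI_star_less_ratio:
  assumes ab: "0 < a" "a < b"
  shows "q_CI_star a b < (b - a) / (b + a)"
proof -
  have "1 \<le> (b + a) / (b - a)"
    using ab by (simp add: field_simps)
  then have "sech (arcosh ((b + a) / (b - a))) = (b - a) / (b + a)"
    by (simp add: sech_def cosh_arcosh_real)
  then show ?thesis
    using exp_minus_less_sech[OF arcosh_ratio_pos[OF ab]] by (simp add: q_CI_star_eq[OF ab])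
qed

theorem mainTheorem2:
  fixes n :: nat and J B :: "real mat" and \<rho>_org a b :: real
  assumes "n > 0"
    and "J \<in> carrier_mat n n"
    and "all_eigenvalues_real J"
    and "\<rho>_org = spectral_radius (map_mat complex_of_real J)"
    and "lambda_min J = 0"
    and "lambda_max J = \<rho>_org"
    and "0 < \<rho>_org" and "\<rho>_org < 1"
    and "B = 1\<^sub>m n - J"
    and "a = lambda_min B"
    and "b = lambda_max B"
  shows "a = 1 - \<rho>_org \<and> b = 1 \<and>
    (\<forall>\<^sub>F T in sequentially. q_CI_star a b < q_CI a b T \<and> q_CI a b T < \<rho>_org)"
proof -
  have a: "a = 1 - \<rho>_org" and b: "b = 1"
    using assms lambda_min_one_minus[of J n] lambda_max_one_minus[of J n] by simp_all
  have ab: "0 < a" "a < b"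
    using assms(7,8) a b by auto
  \<comment> \<open>The denominator is \<open>2 - \<rho>_org > 1\<close>.\<close>
  have "(b - a) / (b + a) < \<rho>_org"
    using assms(7,8) by (simp add: a b field_simps)
  then have "q_CI_star a b < \<rho>_org"
    using q_CI_star_less_ratio[OF ab] by linarith
  moreover have "q_CI a b \<longlonglongrightarrow> q_CI_star a b"
    using q_CI_tendsto[OF ab] by (simp add: q_CI_star_eq[OF ab])
  ultimately have "\<forall>\<^sub>F T in sequentially. q_CI a b T < \<rho>_org"
    by (rule order_tendstoD(2)[rotated])
  then have "\<forall>\<^sub>F T in sequentially. q_CI_star a b < q_CI a b T \<and> q_CI a b T < \<rho>_org"
    \<comment> \<open>The lower bound holds for every positive \<open>T\<close>; largeness serves
      the upper bound.\<close>
    using eventually_gt_at_top[of 0]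
    by eventually_elim (simp add: q_CI_star_less_q_CI[OF ab])
  with a b show ?thesis by blast
qed

end
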